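(* Let $R>0$ and let $p\ge 1$ be a real number (in particular, $p=\frac{p_0}{q_0}$ with $p_0$ odd and $(p_0,q_0)=1$ is allowed). For each positive integer $n$ let $$M_n^+=\{(x_1,\dots,x_n)\in\mathbb{R}^n : x_1^p+\cdots+x_n^p\le nR^p,\ x_k\ge 0,\ k=1,\dots,n\},$$ and suppose that the point $(x_1,\dots,x_n)$ is taken in $M_n^+$ with equiprobability (i.e. uniformly distributed with respect to Lebesgue measure on $M_n^+$). Then: (1) The density of every coordinate $x_k$, as a random variable, is $$\rho_n(x_k)=\frac{p\,\Gamma(1+\frac{n}{p})}{Rn^{\frac1p}\Gamma(\frac1p)\Gamma(1+\frac{n-1}{p})}\Bigl(1-\frac{x_k^p}{nR^p}\Bigr)^{\frac{n-1}{p}}$$ for $x_k\ge0$, $x_k^p\le nR^p$ (and $0$ otherwise), and its limit as $n\to\infty$ is $$\rho(x)=\frac{1}{R\,\Gamma(\frac1p)\,p^{\frac1p-1}}\,e^{-\frac{x^p}{pR^p}},\qquad x\in[0,+\infty).$$ (2) In general, for any $k$ distinct coordinates $x_{i_1},\dots,x_{i_k}$ with $\{i_1,\dots,i_k\}\subset\{1,\dots,n\}$, their joint density is $$\rho_n(x_{i_1},\dots,x_{i_k})=\frac{p^k\,\Gamma(1+\frac np)}{R^kn^{\frac kp}\Gamma^k(\frac1p)\Gamma(1+\frac{n-k}{p})}\Bigl(1-\frac{x_{i_1}^p+\cdots+x_{i_k}^p}{nR^p}\Bigr)^{\frac{n-k}{p}}$$ for $x_{i_j}\ge0$, $x_{i_1}^p+\cdots+x_{i_k}^p\le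 nR^p$ (and $0$ otherwise), and, for fixed $k$, its limit as $n\to\infty$ is $$\rho(x_{i_1},\dots,x_{i_k})=\frac{1}{R^k\Gamma^k(\frac1p)p^{\frac kp-k}}\,e^{-\frac{x_{i_1}^p+\cdots+x_{i_k}^p}{pR^p}},\qquad x_{i_j}\in[0,+\infty),\ j=1,\dots,k,$$ that is, $\rho(x_{i_1},\dots,x_{i_k})=\rho(x_{i_1})\cdots\rho(x_{i_k})$; so in the limit $n\to\infty$ any finitely many coordinates of a point of $M_n^+$, as random variables, are independent (the limiting joint density is the product of the limiting marginal densities).
   Context: $\Gamma$ is the Gamma function and $\Gamma^k(a)=(\Gamma(a))^k$. *)

theory Defs
  imports "HOL-Probability.Probability"
begin

text \<open>
  A point of \<open>\<real>\<^sup>n\<close> is an element of \<open>{1..n} \<rightarrow>\<^sub>E UNIV\<close>, so that \<open>n\<close> can tend to infinity;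
  Lebesgue measure is the product of \<open>n\<close> copies of \<^const>\<open>lborel\<close>.
  All real powers below are \<open>powr\<close> with nonnegative base.
\<close>

definition lborel_pow :: "nat \<Rightarrow> (nat \<Rightarrow> real) measure" where
  "lborel_pow n = (\<Pi>\<^sub>M j\<in>{1..n}. lborel)"

definition Mplus :: "real \<Rightarrow> real \<Rightarrow> nat \<Rightarrow> (nat \<Rightarrow> real) set" where
  "Mplus R p n =
     {x \<in> {1..n} \<rightarrow>\<^sub>E UNIV. (\<forall>k\<in>{1..n}. 0 \<le> x k) \<and> (\<Sum>k=1..n. x k powr p) \<le> real n * R powr p}"

definition uniform_Mplus :: "real \<Rightarrow> real \<Rightarrow> nat \<Rightarrow> (nat \<Rightarrow> real) measure" where
  "uniform_Mplus R p n = uniform_measure (lborel_pow n) (Mplus R p n)"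

definition coord_density :: "real \<Rightarrow> real \<Rightarrow> nat \<Rightarrow> real \<Rightarrow> real" where
  "coord_density R p n x =
     (if 0 \<le> x \<and> x powr p \<le> real n * R powr p
      then p * Gamma (1 + real n / p)
             / (R * real n powr (1 / p) * Gamma (1 / p) * Gamma (1 + (real n - 1) / p))
           * (1 - x powr p / (real n * R powr p)) powr ((real n - 1) / p)
      else 0)"

definition coord_density_lim :: "real \<Rightarrow> real \<Rightarrow> real \<Rightarrow> real" where
  "coord_density_lim R p x =
     (if 0 \<le> x
      then 1 / (R * Gamma (1 / p) * p powr (1 / p - 1)) * exp (- (x powr p / (p * R powr p)))
      else 0)"

text \<open>
  For \<open>n = k\<close> the last factor is \<open>1\<close>, except that it vanishes where the sum equals
  \<open>n * R powr p\<close>, since \<open>0 powr 0 = 0\<close>; this affects the density only on a Lebesgue null set.  The same holds for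
  \<^const>\<open>coord_density\<close> with \<open>n = 1\<close>.
\<close>

definition joint_density :: "real \<Rightarrow> real \<Rightarrow> nat \<Rightarrow> nat \<Rightarrow> (nat \<Rightarrow> real) \<Rightarrow> real" where
  "joint_density R p n k y =
     (if (\<forall>j\<in>{1..k}. 0 \<le> y j) \<and> (\<Sum>j=1..k. y j powr p) \<le> real n * R powr p
      then p ^ k * Gamma (1 + real n / p)
             / (R ^ k * real n powr (real k / p) * Gamma (1 / p) ^ k
                * Gamma (1 + (real n - real k) / p))
           * (1 - (\<Sum>j=1..k. y j powr p) / (real n * R powr p)) powr ((real n - real k) / p)
      else 0)"

definition joint_density_lim :: "real \<Rightarrow> real \<Rightarrow> nat \<Rightarrow> (nat \<Rightarrow> real) \<Rightarrow> real" where
  "joint_density_lim R p k y =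
     (if \<forall>j\<in>{1..k}. 0 \<le> y j
      then 1 / (R ^ k * Gamma (1 / p) ^ k * p powr (real k / p - real k))
           * exp (- ((\<Sum>j=1..k. y j powr p) / (p * R powr p)))
      else 0)"

text \<open>The law on \<open>\<real>\<^sup>k\<close> whose density is the limiting joint density.\<close>

definition limit_law :: "real \<Rightarrow> real \<Rightarrow> nat \<Rightarrow> (nat \<Rightarrow> real) measure" where
  "limit_law R p k = density (lborel_pow k) (\<lambda>y. ennreal (joint_density_lim R p k y))"

end

theory Submission
  imports Defs "HOL-Real_Asymp.Real_Asymp"
begin

text \<open>
  Integrating out one coordinate at a time, each step being a Beta integral, gives the volume
  \<open>\<Gamma>(1 + 1/p)\<^sup>m c\<^bsup>m/p\<^esup> / \<Gamma>(1 + m/p)\<close> of the simplex \<open>x\<^sub>1\<^sup>p + \<dots> + x\<^sub>m\<^sup>p \<le> c\<close>, \<open>x\<^sub>j \<ge> 0\<close>.  By Fubini, the joint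
  density of \<open>k\<close> coordinates at \<open>y\<close> is the volume of the fibre over \<open>y\<close>, a simplex of dimension
  \<open>n - k\<close> with \<open>c = n R\<^sup>p - \<Sum> y\<^sub>j\<^sup>p\<close>, divided by the total volume.  The limit then follows
  from \<open>\<Gamma>(x + a) / \<Gamma>(x) \<sim> x\<^sup>a\<close>, a consequence of the log-convexity of \<open>\<Gamma>\<close>.
\<close>

section \<open>One-dimensional Beta and Gamma integrals in the variable t^p\<close>

text \<open>The substitution t = u^(1/p), with Jacobian u^(1/p - 1) / p, turns integrals of
  functions of t^p into Beta or Gamma integrals. It maps each of (0, 1) and (0, \<infinity>) onto
  itself, so one set \<open>S\<close> serves as both domain and range.\<close>

lemma nn_integral_powr_substitution:
  fixes p B :: real and h :: "real \<Rightarrow> real"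
  assumes p: "p > 0" and S: "S \<in> sets lebesgue" "S \<subseteq> {0<..}" "(\<lambda>u. u powr (1 / p)) ` S = S"
    and h: "\<And>u. u \<in> S \<Longrightarrow> 0 \<le> h u"
    and B: "((\<lambda>u. u powr (1 / p - 1) * h u) has_integral B) S"
  shows "(\<integral>\<^sup>+t. ennreal (h (t powr p)) * indicator S t \<partial>lborel) = ennreal (B / p)"
proof -
  have "((\<lambda>u. u powr (1 / p - 1) * h u * (1 / p)) has_integral B * (1 / p)) S"
    by (rule has_integral_mult_left[OF B])
  moreover have "u powr (1 / p - 1) * h u * (1 / p)
      = \<bar>1 / p * u powr (1 / p - 1)\<bar> * h ((u powr (1 / p)) powr p)" if "u \<in> S" for u
    using that S p by (auto simp: powr_powr)
  ultimately have *: "((\<lambda>u. \<bar>1 / p * u powr (1 / p - 1)\<bar> * h ((u powr (1 / p)) powr p))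
      has_integral B / p) S"
    by (subst has_integral_cong[of _ _ "\<lambda>u. u powr (1 / p - 1) * h u * (1 / p)"]) auto
  have pos: "0 \<le> \<bar>1 / p * u powr (1 / p - 1)\<bar> * h ((u powr (1 / p)) powr p)" if "u \<in> S" for u
    using that S p h[of u] by (auto simp: powr_powr)
  have inj: "inj_on (\<lambda>u. u powr (1 / p)) S"
  proof (rule inj_onI)
    fix x y assume xy: "x \<in> S" "y \<in> S" and "x powr (1 / p) = y powr (1 / p)"
    then have "(x powr (1 / p)) powr p = (y powr (1 / p)) powr p" by simp
    moreover have "x > 0" "y > 0" using xy S(2) by auto
    ultimately show "x = y" using p by (simp add: powr_powr)
  qed
  have der: "((\<lambda>u. u powr (1 / p)) has_field_derivative 1 / p * x powr (1 / p - 1)) (at x within S)"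
    if "x \<in> S" for x
    using that S p by (auto intro!: derivative_eq_intros)
  \<comment> \<open>The change of variables theorem asks for absolute integrability, which
    nonnegativity provides.\<close>
  have "(\<lambda>u. \<bar>1 / p * u powr (1 / p - 1)\<bar> * h ((u powr (1 / p)) powr p)) absolutely_integrable_on S"
    using * pos by (intro nonnegative_absolutely_integrable_1) (auto simp: integrable_on_def)
  then have "(\<lambda>t. h (t powr p)) absolutely_integrable_on (\<lambda>u. u powr (1 / p)) ` S \<and>
      integral ((\<lambda>u. u powr (1 / p)) ` S) (\<lambda>t. h (t powr p)) = B / p"
    using has_absolute_integral_change_of_variables_1'[OF S(1) der inj, of "\<lambda>t. h (t powr p)" "B / p"]
      integral_unique[OF *] by blast
  then have "((\<lambda>t. h (t powr p)) has_integral B / p) S"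
    unfolding S(3) using absolutely_integrable_on_def by (auto simp: has_integral_iff)
  \<comment> \<open>Nonnegativity of \<open>h\<close> is known on \<open>S\<close> only; a point t
    of \<open>S\<close> is u^(1/p) with u in \<open>S\<close>, and then t^p = u.\<close>
  moreover have "0 \<le> h (t powr p)" if "t \<in> S" for t
  proof -
    have "t \<in> (\<lambda>u. u powr (1 / p)) ` S" unfolding S(3) using that .
    then obtain u where "u \<in> S" "t = u powr (1 / p)" by blast
    moreover from this have "u > 0" using S(2) by auto
    ultimately show ?thesis using h[of u] p by (simp add: powr_powr)
  qed
  ultimately show ?thesis
    by (intro nn_integral_has_integral_lebesgue')
qed

text \<open>With u = t^p this is the Beta integral; the exponent \<open>a\<close> of 1 - u
  corresponds to the parameter 1 + a.\<close>

lemma nn_integral_Beta_powr: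
  fixes p a :: real
  assumes p: "p > 0" and a: "a \<ge> 0"
  shows "(\<integral>\<^sup>+t. ennreal ((1 - t powr p) powr a) * indicator {0<..<1} t \<partial>lborel)
    = ennreal (Beta (1 / p) (1 + a) / p)"
proof (rule nn_integral_powr_substitution)
  show "(\<lambda>u. u powr (1 / p)) ` {0<..<1} = {0<..<1::real}"
  proof (intro equalityI subsetI)
    fix y :: real assume "y \<in> {0<..<1}"
    then have "y = (y powr p) powr (1 / p)" "y powr p \<in> {0<..<1}"
      using p by (auto simp: powr_powr powr01_less_one)
    then show "y \<in> (\<lambda>u. u powr (1 / p)) ` {0<..<1}" by blast
  qed (use p in \<open>auto simp: powr01_less_one\<close>)
  show "((\<lambda>u. u powr (1 / p - 1) * (1 - u) powr a) has_integral Beta (1 / p) (1 + a)) {0<..<1}"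
    using has_integral_Beta_real[of "1 / p" "1 + a"] p a by (simp add: has_integral_Icc_iff_Ioo)
qed (use p in auto)

text \<open>Scaling t by b^(1/p) reduces to b = 1, where u = t^p gives Euler's integral for
  Gamma(1/p). At b = p R^p the result normalises the limiting density.\<close>

lemma nn_integral_exp_powr:
  fixes p b :: real
  assumes p: "p > 0" and b: "b > 0"
  shows "(\<integral>\<^sup>+t. ennreal (exp (- (t powr p / b)) * indicator {0..} t) \<partial>lborel)
    = ennreal (b powr (1 / p) * Gamma (1 / p) / p)"
proof -
  have "(\<integral>\<^sup>+t. ennreal (exp (- (t powr p))) * indicator {0<..} t \<partial>lborel) = ennreal (Gamma (1 / p) / p)"
  proof (rule nn_integral_powr_substitution)
    show "(\<lambda>u. u powr (1 / p)) ` {0<..} = ({0<..} :: real set)"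
    proof (intro equalityI subsetI)
      fix y :: real assume "y \<in> {0<..}"
      then have "y = (y powr p) powr (1 / p)" "y powr p \<in> {0<..}"
        using p by (auto simp: powr_powr)
      then show "y \<in> (\<lambda>u. u powr (1 / p)) ` {0<..}" by blast
    qed (use p in auto)
    have "((\<lambda>u. u powr (1 / p - 1) / exp u) has_integral Gamma (1 / p)) {0..}"
      using Gamma_integral_real[of "1 / p"] p by simp
    then have "((\<lambda>u. u powr (1 / p - 1) / exp u) has_integral Gamma (1 / p)) {0<..}"
      by (rule has_integral_spike_set_eq[THEN iffD1, rotated -1])
         (auto intro: negligible_subset[of "{0}"])
    then show "((\<lambda>u. u powr (1 / p - 1) * exp (- u)) has_integral Gamma (1 / p)) {0<..}"
      by (simp add: exp_minus field_simps)
  qed (use p in auto)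
  moreover have "(\<integral>\<^sup>+t. ennreal (exp (- (t powr p / b)) * indicator {0..} t) \<partial>lborel)
      = b powr (1 / p) * (\<integral>\<^sup>+t. ennreal (exp (- (t powr p))) * indicator {0<..} t \<partial>lborel)"
  proof (subst nn_integral_real_affine[where t = 0 and c = "b powr (1 / p)"])
    have "AE t in lborel. t \<noteq> (0::real)" by (rule AE_lborel_singleton)
    then have "(\<integral>\<^sup>+t. ennreal (exp (- ((0 + b powr (1 / p) * t) powr p / b))
            * indicator {0..} (0 + b powr (1 / p) * t)) \<partial>lborel)
        = (\<integral>\<^sup>+t. ennreal (exp (- (t powr p))) * indicator {0<..} t \<partial>lborel)"
      using p b
      by (intro nn_integral_cong_AE, elim eventually_mono)
         (auto simp: indicator_def powr_mult powr_powr zero_le_mult_iff)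
    then show "ennreal \<bar>b powr (1 / p)\<bar> * (\<integral>\<^sup>+t. ennreal (exp (- ((0 + b powr (1 / p) * t) powr p / b))
            * indicator {0..} (0 + b powr (1 / p) * t)) \<partial>lborel)
        = b powr (1 / p) * (\<integral>\<^sup>+t. ennreal (exp (- (t powr p))) * indicator {0<..} t \<partial>lborel)"
      by simp
  qed (use b in auto)
  ultimately show ?thesis
    using p by (simp add: ennreal_mult' [symmetric] Gamma_real_pos less_imp_le)
qed

section \<open>Volume of the p-simplex\<close>

text \<open>For c \<ge> 0, the part of the l^p ball of radius c^(1/p) in the nonnegative orthant;
  empty for c < 0. The index set is arbitrary because the fibres of \<open>Mplus\<close> over chosen
  coordinates have the same shape over the remaining ones.\<close>

definition lp_simplex :: "real \<Rightarrow> 'a set \<Rightarrow> real \<Rightarrow> ('a \<Rightarrow> real) set" where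
  "lp_simplex p I c = {x \<in> I \<rightarrow>\<^sub>E UNIV. (\<forall>k\<in>I. 0 \<le> x k) \<and> (\<Sum>k\<in>I. x k powr p) \<le> c}"

lemma sets_lp_simplex [measurable]:
  assumes [simp]: "finite I"
  shows "lp_simplex p I c \<in> sets (\<Pi>\<^sub>M i\<in>I. lborel)"
proof -
  have "lp_simplex p I c = {x \<in> space (\<Pi>\<^sub>M i\<in>I. lborel). (\<forall>k\<in>I. 0 \<le> x k) \<and> (\<Sum>k\<in>I. x k powr p) \<le> c}"
    by (auto simp: lp_simplex_def space_PiM)
  also have "\<dots> \<in> sets (\<Pi>\<^sub>M i\<in>I. lborel)"
    by measurable
  finally show ?thesis .
qed

text \<open>
  Excludes the boundary \<open>\<Sum> y\<^sub>j\<^sup>p = n R\<^sup>p\<close>, where for \<open>k = n\<close> the density formula is \<open>0\<close> (as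
  \<open>0 powr 0 = 0\<close>) although the fibre is a single point of measure \<open>1\<close>.
\<close>

lemma AE_sum_powr_neq:
  fixes p c :: real
  assumes p: "p > 0" and I: "finite I" "I \<noteq> {}"
  shows "AE x in (\<Pi>\<^sub>M i\<in>I. lborel). (\<forall>k\<in>I. 0 \<le> x k) \<longrightarrow> (\<Sum>k\<in>I. x k powr p) \<noteq> c"
proof -
  interpret product_sigma_finite "\<lambda>_. lborel :: real measure" ..
  obtain i J where J: "I = insert i J" "i \<notin> J" "finite J"
    using I by (metis finite_insert mk_disjoint_insert ex_in_conv)
  let ?N = "{x \<in> space (\<Pi>\<^sub>M i\<in>I. lborel). (\<forall>k\<in>I. 0 \<le> x k) \<and> (\<Sum>k\<in>I. x k powr p) = c}"
  have [measurable]: "?N \<in> sets (\<Pi>\<^sub>M i\<in>I. lborel)"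
    using I by measurable
  have "emeasure (\<Pi>\<^sub>M i\<in>I. lborel) ?N = (\<integral>\<^sup>+x. indicator ?N x \<partial>(\<Pi>\<^sub>M i\<in>I. lborel))"
    by simp
  also have "\<dots> = (\<integral>\<^sup>+x. (\<integral>\<^sup>+t. indicator ?N (x(i := t)) \<partial>lborel) \<partial>(\<Pi>\<^sub>M i\<in>J. lborel))"
    unfolding J(1) using J by (intro product_nn_integral_insert) (auto simp flip: J(1))
  also have "\<dots> = (\<integral>\<^sup>+x. 0 \<partial>(\<Pi>\<^sub>M i\<in>J. lborel :: real measure))"
  proof (rule nn_integral_cong)
    fix x :: "'a \<Rightarrow> real"
    \<comment> \<open>With the other coordinates fixed, the equation has at most one solution t
      \<ge> 0, so each slice is null.\<close>
    have "AE t in lborel. t \<noteq> (c - (\<Sum>k\<in>J. x k powr p)) powr (1 / p)"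
      by (rule AE_lborel_singleton)
    then have "(\<integral>\<^sup>+t. indicator ?N (x(i := t)) \<partial>lborel) = (\<integral>\<^sup>+t. 0 \<partial>(lborel :: real measure))"
    proof (intro nn_integral_cong_AE, elim eventually_mono)
      fix t assume t: "t \<noteq> (c - (\<Sum>k\<in>J. x k powr p)) powr (1 / p)"
      have "x(i := t) \<notin> ?N"
      proof
        assume N: "x(i := t) \<in> ?N"
        have "(\<Sum>k\<in>J. (x(i := t)) k powr p) = (\<Sum>k\<in>J. x k powr p)"
          using J by (intro sum.cong) auto
        with N J have "t \<ge> 0" "t powr p = c - (\<Sum>k\<in>J. x k powr p)"
          by auto
        then show False using t p by (metis powr_powr powr_one nonzero_mult_div_cancel_left
              less_irrefl times_divide_eq_right mult.right_neutral)
      qed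
      then show "indicator ?N (x(i := t)) = (0 :: ennreal)" by simp
    qed
    then show "(\<integral>\<^sup>+t. indicator ?N (x(i := t)) \<partial>lborel) = 0" by simp
  qed
  finally have "?N \<in> null_sets (\<Pi>\<^sub>M i\<in>I. lborel)" by (auto intro: null_setsI)
  then show ?thesis
    by (rule AE_I') auto
qed

text \<open>Induction on the index set, slicing along the new coordinate. \<open>c > 0\<close>
  matters for empty \<open>I\<close>: at c = 0 the set is one point of measure 1, while
  \<open>0 powr 0 = 0\<close> makes the right side 0.\<close>

lemma emeasure_lp_simplex:
  fixes p c :: real
  assumes p: "p > 0" and I: "finite I" and c: "c > 0"
  shows "emeasure (\<Pi>\<^sub>M i\<in>I. lborel) (lp_simplex p I c)
    = ennreal ((Gamma (1 / p) / p) ^ card I * c powr (card I / p) / Gamma (1 + card I / p))"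
  using I c
proof (induction I arbitrary: c rule: finite_induct)
  case empty
  have "lp_simplex p ({} :: 'a set) c = space (\<Pi>\<^sub>M i\<in>{}. lborel)"
    using empty by (auto simp: lp_simplex_def space_PiM)
  then show ?case using empty by (simp add: emeasure_PiM_empty space_PiM)
next
  case (insert i I)
  interpret product_sigma_finite "\<lambda>_. lborel :: real measure" ..
  \<comment> \<open>By the induction hypothesis the slice at t has volume K (c - t^p)^(card I /
    p).\<close>
  define K where "K = (Gamma (1 / p) / p) ^ card I / Gamma (1 + card I / p)"
  have G: "Gamma (1 / p) > 0" "Gamma (1 + card I / p) > 0" "Gamma (1 + card (insert i I) / p) > 0"
    using p by (auto intro!: Gamma_real_pos add_pos_nonneg)
  have K: "K \<ge> 0" using G p by (auto simp: K_def)
  let ?r = "c powr (1 / p)"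
  have r: "?r > 0" "?r powr p = c" using insert.prems p by (auto simp: powr_powr)
  have "emeasure (\<Pi>\<^sub>M i\<in>insert i I. lborel) (lp_simplex p (insert i I) c)
      = (\<integral>\<^sup>+x. indicator (lp_simplex p (insert i I) c) x \<partial>(\<Pi>\<^sub>M i\<in>insert i I. lborel))"
    using insert by simp
  also have "\<dots> = (\<integral>\<^sup>+t. (\<integral>\<^sup>+x. indicator (lp_simplex p (insert i I) c) (x(i := t)) \<partial>(\<Pi>\<^sub>M i\<in>I. lborel)) \<partial>lborel)"
    using insert by (intro product_nn_integral_insert_rev) auto
  also have "\<dots> = (\<integral>\<^sup>+t. ennreal (K * (c - t powr p) powr (card I / p)) * indicator {0<..<?r} t \<partial>lborel)"
  proof (rule nn_integral_cong_AE)
    \<comment> \<open>At t = \<open>?r\<close> the slice has bound c - t^p = 0, outside the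
      induction hypothesis; at t = 0 the indicator of the open interval vanishes although the slice
      has positive volume.\<close>
    have "AE t in lborel. t \<noteq> (0::real)" "AE t in lborel. t \<noteq> ?r"
      by (rule AE_lborel_singleton)+
    then show "AE t in lborel. (\<integral>\<^sup>+x. indicator (lp_simplex p (insert i I) c) (x(i := t)) \<partial>(\<Pi>\<^sub>M i\<in>I. lborel))
        = ennreal (K * (c - t powr p) powr (card I / p)) * indicator {0<..<?r} t"
    proof eventually_elim
      case (elim t)
      have sum_upd: "(\<Sum>k\<in>I. (x(i := t)) k powr p) = (\<Sum>k\<in>I. x k powr p)" for x :: "'a \<Rightarrow> real"
        using insert by (intro sum.cong) auto
      have mem: "x(i := t) \<in> lp_simplex p (insert i I) c \<longleftrightarrow> 0 \<le> t \<and> x \<in> lp_simplex p I (c - t powr p)"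
        if "x \<in> space (\<Pi>\<^sub>M i\<in>I. lborel)" for x
        using that insert sum_upd[of x]
        by (auto simp: lp_simplex_def space_PiM PiE_iff extensional_def)
      have *: "(\<integral>\<^sup>+x. indicator (lp_simplex p (insert i I) c) (x(i := t)) \<partial>(\<Pi>\<^sub>M i\<in>I. lborel))
          = indicator {0..} t * emeasure (\<Pi>\<^sub>M i\<in>I. lborel) (lp_simplex p I (c - t powr p))"
      proof -
        have "(\<integral>\<^sup>+x. indicator (lp_simplex p (insert i I) c) (x(i := t)) \<partial>(\<Pi>\<^sub>M i\<in>I. lborel))
            = (\<integral>\<^sup>+x. indicator {0..} t * indicator (lp_simplex p I (c - t powr p)) x \<partial>(\<Pi>\<^sub>M i\<in>I. lborel))"
          using mem by (intro nn_integral_cong) (auto simp: indicator_def)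
        then show ?thesis using insert by (simp add: nn_integral_cmult)
      qed
      show ?case
      proof (cases "t \<in> {0<..<?r}")
        case True
        then have "t powr p < c"
          using p powr_less_mono2[of p t ?r] r by auto
        then show ?thesis using True insert
          by (simp add: * K_def insert.IH)
      next
        case False
        \<comment> \<open>Outside the interval the slice is empty: t is negative, or it leaves a
          negative bound for the other coordinates.\<close>
        consider "t < 0" | "t > ?r" using False elim by force
        then show ?thesis
        proof cases
          case 2
          then have "t powr p > c"
            using p powr_less_mono2[of p ?r t] r by auto
          then have "\<not> (\<Sum>k\<in>I. x k powr p) \<le> c - t powr p" for x :: "'a \<Rightarrow> real"
            using sum_nonneg[of I "\<lambda>k. x k powr p"] by simp
          then have "lp_simplex p I (c - t powr p) = {}"
            by (auto simp: lp_simplex_def)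
          then show ?thesis using False by (simp add: *)
        qed (use False in \<open>simp add: *\<close>)
      qed
    qed
  qed
  \<comment> \<open>Since \<open>?r powr p = c\<close>, replacing t by \<open>?r * t\<close> pulls
    out a power of c and leaves a Beta integral over (0, 1).\<close>
  also have "\<dots> = ?r * (\<integral>\<^sup>+t. ennreal (K * (c - (0 + ?r * t) powr p) powr (card I / p))
        * indicator {0<..<?r} (0 + ?r * t) \<partial>lborel)"
    using r by (subst nn_integral_real_affine[where t = 0 and c = ?r]) auto
  also have "(\<lambda>t. ennreal (K * (c - (0 + ?r * t) powr p) powr (card I / p)) * indicator {0<..<?r} (0 + ?r * t))
      = (\<lambda>t. ennreal (K * c powr (card I / p)) * (ennreal ((1 - t powr p) powr (card I / p)) * indicator {0<..<1} t))"
  proof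
    fix t
    have "ennreal (K * (c - (?r * t) powr p) powr (card I / p))
        = ennreal (K * c powr (card I / p)) * ennreal ((1 - t powr p) powr (card I / p))" if t: "0 < t" "t < 1"
    proof -
      have "t powr p < 1" using t p by (simp add: powr01_less_one)
      moreover have "c - (?r * t) powr p = c * (1 - t powr p)"
        using t r by (simp add: powr_mult algebra_simps)
      ultimately show ?thesis
        using insert.prems K by (simp add: powr_mult ennreal_mult'[symmetric] mult.assoc)
    qed
    then show "ennreal (K * (c - (0 + ?r * t) powr p) powr (card I / p)) * indicator {0<..<?r} (0 + ?r * t)
        = ennreal (K * c powr (card I / p)) * (ennreal ((1 - t powr p) powr (card I / p)) * indicator {0<..<1} t)"
      using r by (auto simp: indicator_def zero_less_mult_iff)
  qed
  also have "(\<integral>\<^sup>+t. ennreal (K * c powr (card I / p)) * (ennreal ((1 - t powr p) powr (card I / p))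
      * indicator {0<..<1} t) \<partial>lborel)
      = ennreal (K * c powr (card I / p)) * ennreal (Beta (1 / p) (1 + card I / p) / p)"
    using p by (subst nn_integral_cmult) (auto simp: nn_integral_Beta_powr)
  also have "ennreal ?r * (ennreal (K * c powr (card I / p)) * ennreal (Beta (1 / p) (1 + card I / p) / p))
      = ennreal (?r * (K * c powr (card I / p)) * (Beta (1 / p) (1 + card I / p) / p))"
    using K r by (simp add: ennreal_mult'[symmetric] mult.assoc)
  \<comment> \<open>With m = card I, Beta(1/p, 1 + m/p) = Gamma(1/p) Gamma(1 + m/p) / Gamma(1 + (m +
    1)/p), and Gamma(1 + m/p) cancels the denominator of \<open>K\<close>.\<close>
  also have "?r * (K * c powr (card I / p)) * (Beta (1 / p) (1 + card I / p) / p)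
      = (Gamma (1 / p) / p) ^ card (insert i I) * c powr (card (insert i I) / p)
        / Gamma (1 + card (insert i I) / p)"
  proof -
    have e1: "c powr (card (insert i I) / p) = ?r * c powr (card I / p)"
      using insert by (simp add: powr_add[symmetric] add_divide_distrib)
    have e2: "1 / p + (1 + card I / p) = 1 + card (insert i I) / p"
      using insert by (simp add: add_divide_distrib)
    have e3: "(Gamma (1 / p) / p) ^ card (insert i I) = (Gamma (1 / p) / p) * (Gamma (1 / p) / p) ^ card I"
      using insert.hyps by simp
    show ?thesis
      unfolding Beta_def e1 e2 e3 K_def using G(2) by (simp add: field_simps del: power_divide)
  qed
  finally show ?case .
qed

section \<open>Gamma quotients and pointwise limits of the densities\<close>

lemma Gamma_ratio_bounds:
  fixes x a :: real
  assumes x: "x > 1" and a: "a > 0"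
  shows "(x - 1) powr a \<le> Gamma (x + a) / Gamma x" "Gamma (x + a) / Gamma x \<le> (x + a) powr a"
proof -
  let ?f = "\<lambda>t::real. ln (Gamma t)"
  have cv: "convex_on {0<..} ?f"
    using log_convex_Gamma_real by (simp add: o_def)
  \<comment> \<open>The functional equation makes the slopes of \<open>?f\<close> on [x - 1, x] and
    [x + a, x + a + 1] explicit: ln (x - 1) and ln (x + a). Here \<open>x > 1\<close> keeps the left
    interval inside the domain of convexity.\<close>
  have step: "?f (t + 1) - ?f t = ln t" if "t > 0" for t
  proof -
    have "Gamma (t + 1) = t * Gamma t" using that by (intro Gamma_plus1) (auto elim!: nonpos_Ints_cases)
    then show ?thesis using that Gamma_real_pos[OF that] by (simp add: ln_mult_pos)
  qed
  have G: "Gamma x > 0" "Gamma (x + a) > 0" using x a by (auto intro: Gamma_real_pos)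
  have ratio: "Gamma (x + a) / Gamma x = exp (?f (x + a) - ?f x)"
    using G by (simp add: exp_diff)
  \<comment> \<open>The slope of \<open>ln \<circ> \<Gamma>\<close> on \<open>[x, x + a]\<close> lies between those on the unit intervals to its left and right.\<close>
  have "(?f x - ?f (x - 1)) / (x - (x - 1)) \<le> (?f (x + a) - ?f x) / (x + a - x)"
    using convex_on_slope_le[OF cv, of "x - 1" "x + a" x] x a by (auto simp: divide_simps algebra_simps)
  then have "a * ln (x - 1) \<le> ?f (x + a) - ?f x"
    using step[of "x - 1"] x a by (simp add: field_simps)
  then show "(x - 1) powr a \<le> Gamma (x + a) / Gamma x"
    unfolding ratio powr_def using x by simp
  have "(?f (x + a) - ?f x) / (x + a - x) \<le> (?f (x + a + 1) - ?f (x + a)) / (x + a + 1 - (x + a))"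
    using convex_on_slope_le[OF cv, of x "x + a + 1" "x + a"] x a by (auto simp: divide_simps algebra_simps)
  then have "?f (x + a) - ?f x \<le> a * ln (x + a)"
    using step[of "x + a"] x a by (simp add: field_simps)
  then show "Gamma (x + a) / Gamma x \<le> (x + a) powr a"
    unfolding ratio powr_def using x a by simp
qed

text \<open>Squeeze by \<open>Gamma_ratio_bounds\<close> at x = 1 + (n - k)/p and a = k/p;
  \<open>n > k\<close> gives x > 1.\<close>

lemma tendsto_Gamma_ratio:
  fixes p :: real
  assumes p: "p > 0" and k: "k \<ge> 1"
  shows "(\<lambda>n. Gamma (1 + real n / p) / (real n powr (real k / p) * Gamma (1 + (real n - real k) / p)))
    \<longlonglongrightarrow> p powr (- (real k / p))"
proof (rule tendsto_sandwich)
  define K where "K = real k"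
  have K: "K > 0" using k by (simp add: K_def)
  \<comment> \<open>1/p is the common limit of ((n - K)/p)/n and (1 + n/p)/n, the bases in the two
    bounds.\<close>
  have pK: "p powr (- (K / p)) = inverse p powr (K / p)"
    using p by (simp add: powr_minus inverse_powr)
  have bounds: "((real n - real k) / p) powr (real k / p) / real n powr (real k / p)
        \<le> Gamma (1 + real n / p) / (real n powr (real k / p) * Gamma (1 + (real n - real k) / p)) \<and>
      Gamma (1 + real n / p) / (real n powr (real k / p) * Gamma (1 + (real n - real k) / p))
        \<le> (1 + real n / p) powr (real k / p) / real n powr (real k / p)" if n: "n > k" for n
  proof -
    have *: "1 + (real n - real k) / p + real k / p = 1 + real n / p"
      using p by (simp add: field_simps)
    show ?thesis
      using Gamma_ratio_bounds[of "1 + (real n - real k) / p" "real k / p"] n p k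
      unfolding * by (auto simp: field_simps)
  qed
  show "\<forall>\<^sub>F n in sequentially. ((real n - real k) / p) powr (real k / p) / real n powr (real k / p)
        \<le> Gamma (1 + real n / p) / (real n powr (real k / p) * Gamma (1 + (real n - real k) / p))"
    using eventually_gt_at_top[of k] by eventually_elim (use bounds in blast)
  show "\<forall>\<^sub>F n in sequentially. 
      Gamma (1 + real n / p) / (real n powr (real k / p) * Gamma (1 + (real n - real k) / p))
        \<le> (1 + real n / p) powr (real k / p) / real n powr (real k / p)"
    using eventually_gt_at_top[of k] by eventually_elim (use bounds in blast)
  show "(\<lambda>n. ((real n - real k) / p) powr (real k / p) / real n powr (real k / p)) \<longlonglongrightarrow> p powr (- (real k / p))"
    unfolding K_def[symmetric] pK using p K by real_asymp
  show "(\<lambda>n. (1 + real n / p) powr (real k / p) / real n powr (real k / p)) \<longlonglongrightarrow> p powr (- (real k / p))"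
    unfolding K_def[symmetric] pK using p K by real_asymp
qed

text \<open>The classical limit (1 + x/n)^n \<rightarrow> e^x with x = -s/c, raised to the power
  1/p. The shift of the exponent by -k/p is harmless because the base tends to 1.\<close>

lemma tendsto_powr_exp:
  fixes s p c k :: real
  assumes p: "p > 0" and c: "c > 0" and s: "s \<ge> 0"
  shows "(\<lambda>n. (1 - s / (real n * c)) powr ((real n - k) / p)) \<longlonglongrightarrow> exp (- (s / (p * c)))"
proof (cases "s = 0")
  case False
  then have "(\<lambda>n. (1 - s / (real n * c)) powr ((real n - k) / p)) \<longlonglongrightarrow> exp (- (s * inverse c * inverse p))"
    using assms by real_asymp
  then show ?thesis by (simp add: field_simps)
qed simp

lemma joint_density_tendsto:
  fixes R p :: real
  assumes R: "R > 0" and p: "p > 0" and k: "k \<ge> 1" and y: "\<And>j. j \<in> {1..k} \<Longrightarrow> 0 \<le> y j"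
  shows "(\<lambda>n. joint_density R p n k y) \<longlonglongrightarrow> joint_density_lim R p k y"
proof -
  define s where "s = (\<Sum>j=1..k. y j powr p)"
  have s: "s \<ge> 0" unfolding s_def by (intro sum_nonneg) auto
  have Rp: "R powr p > 0" using R by simp
  have "\<forall>\<^sub>F n in sequentially. s \<le> real n * R powr p"
    using Rp by real_asymp
  \<comment> \<open>A fixed point y satisfies the constraint for all large n; from then on only the
    first branch of the density counts.\<close>
  then have ev: "\<forall>\<^sub>F n in sequentially. joint_density R p n k y =
      p ^ k / (R ^ k * Gamma (1 / p) ^ k)
      * (Gamma (1 + real n / p) / (real n powr (real k / p) * Gamma (1 + (real n - real k) / p)))
      * (1 - s / (real n * R powr p)) powr ((real n - real k) / p)"
    by eventually_elim (use y in \<open>simp add: joint_density_def s_def\<close>)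
  have "joint_density_lim R p k y
      = p ^ k / (R ^ k * Gamma (1 / p) ^ k) * p powr (- (real k / p)) * exp (- (s / (p * R powr p)))"
  proof -
    have "p powr (real k / p - real k) = p powr (real k / p) / p ^ k"
      using p by (simp add: powr_diff powr_realpow)
    then show ?thesis using y by (simp add: joint_density_lim_def s_def powr_minus divide_inverse)
  qed
  moreover have "(\<lambda>n. p ^ k / (R ^ k * Gamma (1 / p) ^ k)
      * (Gamma (1 + real n / p) / (real n powr (real k / p) * Gamma (1 + (real n - real k) / p)))
      * (1 - s / (real n * R powr p)) powr ((real n - real k) / p))
    \<longlonglongrightarrow> p ^ k / (R ^ k * Gamma (1 / p) ^ k) * p powr (- (real k / p)) * exp (- (s / (p * R powr p)))"
    by (intro tendsto_mult tendsto_const tendsto_Gamma_ratio tendsto_powr_exp p k Rp s)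
  ultimately show ?thesis
    using ev by (simp add: tendsto_cong)
qed

section \<open>The limiting law as a product measure\<close>

lemma coord_density_eq_joint_density:
  assumes "R > 0"
  shows "coord_density R p n x = joint_density R p n 1 (\<lambda>_. x)"
  using assms by (simp add: coord_density_def joint_density_def)

lemma coord_density_lim_eq_joint_density_lim:
  assumes "R > 0"
  shows "coord_density_lim R p x = joint_density_lim R p 1 (\<lambda>_. x)"
  using assms by (simp add: coord_density_lim_def joint_density_lim_def)

text \<open>The exponential of a sum is a product, and the constant is a k-th power. If some
  coordinate is negative, both sides are 0.\<close>

lemma joint_density_lim_eq_prod:
  fixes R p :: real
  assumes p: "p > 0"
  shows "joint_density_lim R p k y = (\<Prod>j=1..k. coord_density_lim R p (y j))"
proof (cases "\<forall>j\<in>{1..k}. 0 \<le> y j")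
  case True
  have "(p powr (1 / p - 1)) ^ k = p powr (real k / p - real k)"
    using p by (simp add: powr_realpow[symmetric] powr_powr algebra_simps)
  moreover have "(\<Prod>j=1..k. exp (- (y j powr p / (p * R powr p))))
      = exp (- ((\<Sum>j=1..k. y j powr p) / (p * R powr p)))"
    by (simp add: exp_sum[symmetric] sum_negf sum_divide_distrib)
  moreover have "(\<Prod>j=1..k. coord_density_lim R p (y j)) = (\<Prod>j=1..k.
      1 / (R * Gamma (1 / p) * p powr (1 / p - 1)) * exp (- (y j powr p / (p * R powr p))))"
    using True by (intro prod.cong) (auto simp: coord_density_lim_def)
  ultimately show ?thesis
    using True by (simp add: joint_density_lim_def prod.distrib prod_dividef power_mult_distrib power_divide)
next
  case False
  then have "\<exists>j\<in>{1..k}. coord_density_lim R p (y j) = 0"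
    by (auto simp: coord_density_lim_def)
  then have "(\<Prod>j=1..k. coord_density_lim R p (y j)) = 0"
    by (simp add: prod_zero_iff)
  then show ?thesis using False by (auto simp: joint_density_lim_def)
qed

lemma measurable_coord_density_lim [measurable]: "coord_density_lim R p \<in> borel_measurable borel"
  unfolding coord_density_lim_def by measurable

lemma measurable_joint_density [measurable]: "joint_density R p n k \<in> borel_measurable (lborel_pow k)"
  unfolding joint_density_def lborel_pow_def by measurable

lemma coord_density_lim_nonneg:
  assumes "R > 0" "p > 0"
  shows "coord_density_lim R p x \<ge> 0"
  using assms by (auto simp: coord_density_lim_def intro!: mult_nonneg_nonneg less_imp_le[OF Gamma_real_pos])

text \<open>The factor of which \<open>limit_law\<close> is shown to be a k-fold product; total mass
  1 and independence are read off from that.\<close>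

definition limit_coord_law :: "real \<Rightarrow> real \<Rightarrow> real measure" where
  "limit_coord_law R p = density lborel (\<lambda>x. ennreal (coord_density_lim R p x))"

lemma sets_limit_coord_law [measurable_cong, simp]: "sets (limit_coord_law R p) = sets borel"
  by (simp add: limit_coord_law_def)

lemma prob_space_limit_coord_law:
  fixes R p :: real
  assumes R: "R > 0" and p: "p > 0"
  shows "prob_space (limit_coord_law R p)"
proof (rule prob_spaceI)
  define b C where "b = p * R powr p" and "C = 1 / (R * Gamma (1 / p) * p powr (1 / p - 1))"
  have b: "b > 0" "b powr (1 / p) = p powr (1 / p) * R" 
    using R p by (auto simp: b_def powr_mult powr_powr)
  have G: "Gamma (1 / p) > 0" using p by (simp add: Gamma_real_pos)
  have C: "C \<ge> 0" using R G by (simp add: C_def)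
  have "coord_density_lim R p x = C * (exp (- (x powr p / b)) * indicator {0..} x)" for x
    by (auto simp: coord_density_lim_def b_def C_def)
  then have "emeasure (limit_coord_law R p) (space (limit_coord_law R p))
      = (\<integral>\<^sup>+x. ennreal C * ennreal (exp (- (x powr p / b)) * indicator {0..} x) \<partial>lborel)"
    using C by (simp add: limit_coord_law_def emeasure_density ennreal_mult')
  also have "\<dots> = ennreal C * ennreal (b powr (1 / p) * Gamma (1 / p) / p)"
    using p b by (subst nn_integral_cmult) (auto simp: nn_integral_exp_powr)
  also have "\<dots> = ennreal (C * (b powr (1 / p) * Gamma (1 / p) / p))"
    using C by (simp add: ennreal_mult'[symmetric])
  also have "C * (b powr (1 / p) * Gamma (1 / p) / p) = 1"
    using R p less_imp_neq[OF G] by (simp add: b(2) C_def powr_diff)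
  finally show "emeasure (limit_coord_law R p) (space (limit_coord_law R p)) = 1" by simp
qed

text \<open>A product of sigma-finite measures is determined by its values on boxes. On a box the
  density and the indicator both factor over the coordinates, so Tonelli splits the
  integral.\<close>

lemma limit_law_eq_PiM:
  fixes R p :: real
  assumes R: "R > 0" and p: "p > 0"
  shows "limit_law R p k = (\<Pi>\<^sub>M j\<in>{1..k}. limit_coord_law R p)"
proof -
  interpret lb: product_sigma_finite "\<lambda>_. lborel :: real measure" ..
  interpret lc: prob_space "limit_coord_law R p" by (rule prob_space_limit_coord_law[OF R p])
  interpret product_sigma_finite "\<lambda>_. limit_coord_law R p" ..
  show ?thesis
  proof (rule PiM_eqI)
    show "sets (limit_law R p k) = sets (\<Pi>\<^sub>M j\<in>{1..k}. limit_coord_law R p)"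
      by (auto simp: limit_law_def lborel_pow_def intro!: sets_PiM_cong)
    fix A assume "\<And>i. i \<in> {1..k} \<Longrightarrow> A i \<in> sets (limit_coord_law R p)"
    then have A[measurable]: "A i \<in> sets borel" if "i \<in> {1..k}" for i using that by simp
    have PA [measurable]: "Pi\<^sub>E {1..k} A \<in> sets (lborel_pow k)"
      unfolding lborel_pow_def by (intro sets_PiM_I_finite) auto
    have "emeasure (limit_law R p k) (Pi\<^sub>E {1..k} A)
        = (\<integral>\<^sup>+y. ennreal (joint_density_lim R p k y) * indicator (Pi\<^sub>E {1..k} A) y \<partial>lborel_pow k)"
      unfolding limit_law_def joint_density_lim_eq_prod[OF p]
      by (subst emeasure_density) (use PA in \<open>auto simp: lborel_pow_def\<close>)
    also have "\<dots> = (\<integral>\<^sup>+y. (\<Prod>j=1..k. ennreal (coord_density_lim R p (y j)) * indicator (A j) (y j)) \<partial>lborel_pow k)"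
    proof (rule nn_integral_cong)
      fix y assume "y \<in> space (lborel_pow k)"
      then have "indicator (Pi\<^sub>E {1..k} A) y = (\<Prod>j=1..k. indicator (A j) (y j) :: ennreal)"
        by (auto simp: lborel_pow_def space_PiM PiE_iff indicator_def prod_zero_iff)
      then show "ennreal (joint_density_lim R p k y) * indicator (Pi\<^sub>E {1..k} A) y
          = (\<Prod>j=1..k. ennreal (coord_density_lim R p (y j)) * indicator (A j) (y j))"
        by (simp add: joint_density_lim_eq_prod[OF p] prod.distrib prod_ennreal coord_density_lim_nonneg[OF R p])
    qed
    also have "\<dots> = (\<Prod>j=1..k. \<integral>\<^sup>+x. ennreal (coord_density_lim R p x) * indicator (A j) x \<partial>lborel)"
      unfolding lborel_pow_def by (intro lb.product_nn_integral_prod) auto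
    also have "\<dots> = (\<Prod>j\<in>{1..k}. emeasure (limit_coord_law R p) (A j))"
      unfolding limit_coord_law_def by (intro prod.cong) (auto simp: emeasure_density)
    finally show "emeasure (limit_law R p k) (Pi\<^sub>E {1..k} A)
        = (\<Prod>j\<in>{1..k}. emeasure (limit_coord_law R p) (A j))" .
  qed simp
qed

text \<open>Independence means that the joint law is the product of the marginals. Under
  \<open>PiM I M\<close> the joint law of the coordinates is the measure itself, and the i-th
  marginal is \<open>M i\<close>.\<close>

lemma indep_vars_PiM_components:
  assumes I: "finite I" "I \<noteq> {}" and M: "\<And>i. prob_space (M i)"
  shows "prob_space.indep_vars (PiM I M) M (\<lambda>i x. x i) I"
proof -
  interpret product_prob_space M by (intro product_prob_spaceI M)
  interpret P: prob_space "PiM I M" by (intro prob_space_PiM M)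
  have "distr (PiM I M) (PiM I M) (\<lambda>x. \<lambda>i\<in>I. x i) = PiM I M"
    using distr_restrict[of I I] I by simp
  moreover have "PiM I M = PiM I (\<lambda>i. distr (PiM I M) (M i) (\<lambda>x. x i))"
    using I by (intro PiM_cong) (auto simp: PiM_component)
  ultimately show ?thesis
    using I by (subst P.indep_vars_iff_distr_eq_PiM') auto
qed

section \<open>Exact densities for finite n\<close>

text \<open>Relabelling the axes preserves Lebesgue measure. It suffices to check boxes, whose
  preimages are boxes with the sides relabelled by the inverse of \<open>i\<close>.\<close>

lemma distr_PiM_lborel_reindex:
  fixes i :: "'a \<Rightarrow> 'b"
  assumes K: "finite K" and i: "inj_on i K"
  shows "distr (\<Pi>\<^sub>M j\<in>i ` K. lborel :: real measure) (\<Pi>\<^sub>M j\<in>K. lborel) (\<lambda>x. \<lambda>j\<in>K. x (i j)) = (\<Pi>\<^sub>M j\<in>K. lborel)"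
proof -
  interpret lb: product_sigma_finite "\<lambda>_. lborel :: real measure" ..
  have [measurable]: "(\<lambda>x. \<lambda>j\<in>K. x (i j)) \<in> (\<Pi>\<^sub>M j\<in>i ` K. lborel :: real measure) \<rightarrow>\<^sub>M (\<Pi>\<^sub>M j\<in>K. lborel)"
    by (intro measurable_restrict measurable_component_singleton) auto
  show ?thesis
  proof (rule lb.PiM_eqI)
    fix A :: "'a \<Rightarrow> real set" assume A: "\<And>j. j \<in> K \<Longrightarrow> A j \<in> sets lborel"
    let ?A = "\<lambda>l. A (the_inv_into K i l)"
    have eq: "(\<lambda>x. \<lambda>j\<in>K. x (i j)) -` Pi\<^sub>E K A \<inter> space (\<Pi>\<^sub>M j\<in>i ` K. lborel) = Pi\<^sub>E (i ` K) ?A"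
      using i by (auto simp: space_PiM PiE_iff the_inv_into_f_f)
    have "emeasure (distr (\<Pi>\<^sub>M j\<in>i ` K. lborel) (\<Pi>\<^sub>M j\<in>K. lborel) (\<lambda>x. \<lambda>j\<in>K. x (i j))) (Pi\<^sub>E K A)
        = emeasure (\<Pi>\<^sub>M j\<in>i ` K. lborel) (Pi\<^sub>E (i ` K) ?A)"
      using A K by (subst emeasure_distr) (auto simp: eq intro!: sets_PiM_I_finite)
    also have "\<dots> = (\<Prod>l\<in>i ` K. emeasure lborel (?A l))"
      using A K i by (intro lb.emeasure_PiM) (auto simp: the_inv_into_f_f)
    also have "\<dots> = (\<Prod>j\<in>K. emeasure lborel (A j))"
      using i by (subst prod.reindex) (auto simp: the_inv_into_f_f)
    finally show "emeasure (distr (\<Pi>\<^sub>M j\<in>i ` K. lborel) (\<Pi>\<^sub>M j\<in>K. lborel) (\<lambda>x. \<lambda>j\<in>K. x (i j))) (Pi\<^sub>E K A)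
        = (\<Prod>j\<in>K. emeasure lborel (A j))" .
  qed (use K in auto)
qed

lemma Mplus_eq_lp_simplex: "Mplus R p n = lp_simplex p {1..n} (real n * R powr p)"
  by (simp add: Mplus_def lp_simplex_def)

text \<open>Density times total volume equals fibre volume: the second factor on the left is the
  volume of \<open>Mplus R p n\<close>, and the right side is that of the (n - k)-dimensional fibre
  over y.\<close>

lemma joint_density_eq_ratio:
  fixes R p :: real
  assumes R: "R > 0" and p: "p > 0" and n: "n \<ge> 1" and kn: "k \<le> n"
    and y: "\<And>j. j \<in> {1..k} \<Longrightarrow> 0 \<le> y j" and s: "(\<Sum>j=1..k. y j powr p) < real n * R powr p"
  shows "joint_density R p n k y
      * ((Gamma (1 / p) / p) ^ n * (real n * R powr p) powr (n / p) / Gamma (1 + n / p))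
    = (Gamma (1 / p) / p) ^ (n - k) * (real n * R powr p - (\<Sum>j=1..k. y j powr p)) powr (real (n - k) / p)
      / Gamma (1 + real (n - k) / p)"
proof -
  define S c where "S = (\<Sum>j=1..k. y j powr p)" and "c = real n * R powr p"
  have c: "c > 0" using R n by (simp add: c_def)
  have S: "S < c" using s by (simp add: S_def c_def)
  have G: "Gamma (1 / p) > 0" "Gamma (1 + n / p) > 0" "Gamma (1 + real (n - k) / p) > 0"
    using p by (auto intro!: Gamma_real_pos add_pos_nonneg)
  have nk: "real n - real k = real (n - k)" using kn by simp
  \<comment> \<open>The exponent k/p split off here produces the factor n^(k/p) R^k in the
    denominator of the density.\<close>
  have ck: "c powr (n / p) = c powr (real (n - k) / p) * (real n powr (k / p) * R ^ k)"
  proof -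
    have "n / p = real (n - k) / p + k / p" using kn by (simp add: add_divide_distrib[symmetric])
    then have "c powr (n / p) = c powr (real (n - k) / p) * c powr (k / p)"
      by (simp only: powr_add)
    also have "c powr (k / p) = real n powr (k / p) * R ^ k"
      using R p by (simp add: c_def powr_mult powr_powr powr_realpow)
    finally show ?thesis .
  qed
  have "c - S = c * (1 - S / c)" using c by (simp add: field_simps)
  then have cS: "(c - S) powr (real (n - k) / p) = c powr (real (n - k) / p) * (1 - S / c) powr (real (n - k) / p)"
    using c S by (simp add: powr_mult)
  have gk: "(Gamma (1 / p) / p) ^ n = (Gamma (1 / p) / p) ^ (n - k) * (Gamma (1 / p) ^ k / p ^ k)"
    using kn by (simp add: power_divide[symmetric] power_add[symmetric])
  have "joint_density R p n k y = p ^ k * Gamma (1 + n / p)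
      / (R ^ k * real n powr (k / p) * Gamma (1 / p) ^ k * Gamma (1 + real (n - k) / p))
      * (1 - S / c) powr (real (n - k) / p)"
    using y S unfolding joint_density_def S_def c_def nk by simp
  then show ?thesis
    unfolding S_def[symmetric] c_def[symmetric] ck cS gk using G[THEN less_imp_neq] R p n by simp
qed

text \<open>Tonelli over the chosen and the remaining coordinates: the inner integral is a fibre
  volume, which is the density times the total volume almost everywhere. Relabelling then moves the
  outer integral to \<open>{1..k}\<close>.\<close>

lemma distributed_joint:
  fixes R p :: real and i :: "nat \<Rightarrow> nat"
  assumes R: "R > 0" and p: "p > 0" and k: "1 \<le> k" and i: "inj_on i {1..k}" "i ` {1..k} \<subseteq> {1..n}"
  shows "distributed (uniform_Mplus R p n) (lborel_pow k) (\<lambda>x. \<lambda>j\<in>{1..k}. x (i j))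
    (\<lambda>y. ennreal (joint_density R p n k y))"
proof -
  interpret product_sigma_finite "\<lambda>_. lborel :: real measure" ..
  define c V where "c = real n * R powr p"
    and "V = (Gamma (1 / p) / p) ^ n * c powr (n / p) / Gamma (1 + n / p)"
  \<comment> \<open>\<open>J\<close> holds the chosen coordinates; those in \<open>L\<close> are
    integrated out.\<close>
  define J L where "J = i ` {1..k}" and "L = {1..n} - J"
  have "card J = k" using i by (simp add: J_def card_image)
  then have kn: "k \<le> n" using card_mono[of "{1..n}" J] i by (simp add: J_def)
  have L: "card L = n - k" using i \<open>card J = k\<close> by (simp add: L_def J_def card_Diff_subset)
  have JL: "J \<inter> L = {}" "finite J" "finite L" "J \<union> L = {1..n}" "J \<noteq> {}"
    using i k by (auto simp: J_def L_def)
  have n: "n \<ge> 1" using k kn by simp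
  have c: "c > 0" using R n by (simp add: c_def)
  have V: "V > 0"
    using p c by (auto simp: V_def intro!: mult_pos_pos divide_pos_pos zero_less_power Gamma_real_pos add_pos_nonneg)
  let ?X = "\<lambda>x. \<lambda>j\<in>{1..k}. x (i j)"
  let ?P = "\<Pi>\<^sub>M j\<in>{1..n}. lborel :: real measure"
  let ?PJ = "\<Pi>\<^sub>M j\<in>J. lborel :: real measure"
  let ?PL = "\<Pi>\<^sub>M j\<in>L. lborel :: real measure"
  let ?Q = "\<Pi>\<^sub>M j\<in>{1..k}. lborel :: real measure"
  have Xn [measurable]: "?X \<in> ?P \<rightarrow>\<^sub>M ?Q"
    using i(2) by (intro measurable_restrict measurable_component_singleton) (simp add: image_subset_iff)
  have XJ [measurable]: "?X \<in> ?PJ \<rightarrow>\<^sub>M ?Q"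
    by (intro measurable_restrict measurable_component_singleton) (auto simp: J_def)
  have M [measurable]: "lp_simplex p {1..n} c \<in> sets ?P" by simp
  have volM: "emeasure ?P (lp_simplex p {1..n} c) = ennreal V"
    using emeasure_lp_simplex[OF p _ c, of "{1..n}"] by (simp add: V_def)
  have dens [measurable]: "joint_density R p n k \<in> borel_measurable ?Q"
    using measurable_joint_density[of R p n k] by (simp add: lborel_pow_def)
  have U: "uniform_Mplus R p n = uniform_measure ?P (lp_simplex p {1..n} c)"
    by (simp add: uniform_Mplus_def lborel_pow_def Mplus_eq_lp_simplex c_def)
  have XU: "?X \<in> uniform_measure ?P (lp_simplex p {1..n} c) \<rightarrow>\<^sub>M ?Q"
    using Xn by (simp add: measurable_def)
  have "distr (uniform_measure ?P (lp_simplex p {1..n} c)) ?Q ?X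
      = density ?Q (\<lambda>y. ennreal (joint_density R p n k y))"
  proof (rule measure_eqI)
    fix A assume "A \<in> sets (distr (uniform_measure ?P (lp_simplex p {1..n} c)) ?Q ?X)"
    then have A [measurable]: "A \<in> sets ?Q" by simp
    have pre [measurable]: "?X -` A \<inter> space ?P \<in> sets ?P" by measurable
    have meas: "(\<lambda>x. indicator (lp_simplex p {1..n} c) x * indicator A (?X x) :: ennreal) \<in> borel_measurable ?P"
      by measurable
    have "emeasure ?P (lp_simplex p {1..n} c \<inter> (?X -` A \<inter> space ?P))
        = (\<integral>\<^sup>+x. indicator (lp_simplex p {1..n} c) x * indicator A (?X x) \<partial>?P)"
      by (subst nn_integral_indicator[OF sets.Int[OF M pre], symmetric]) (auto intro!: nn_integral_cong simp: indicator_def)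
    also have "\<dots> = (\<integral>\<^sup>+y. (\<integral>\<^sup>+z. indicator (lp_simplex p {1..n} c) (merge J L (y, z))
        * indicator A (?X (merge J L (y, z))) \<partial>?PL) \<partial>?PJ)"
      by (rule product_nn_integral_fold[OF JL(1-3), unfolded JL(4), OF meas])
    also have "\<dots> = (\<integral>\<^sup>+y. ennreal V * (ennreal (joint_density R p n k (?X y)) * indicator A (?X y)) \<partial>?PJ)"
    proof (rule nn_integral_cong_AE)
      have "AE y in ?PJ. (\<forall>k\<in>J. 0 \<le> y k) \<longrightarrow> (\<Sum>k\<in>J. y k powr p) \<noteq> c"
        by (rule AE_sum_powr_neq) (use p JL in auto)
      then show "AE y in ?PJ. (\<integral>\<^sup>+z. indicator (lp_simplex p {1..n} c) (merge J L (y, z))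
          * indicator A (?X (merge J L (y, z))) \<partial>?PL)
        = ennreal V * (ennreal (joint_density R p n k (?X y)) * indicator A (?X y))"
      proof (rule AE_mp, intro AE_I2 impI)
        fix y assume y: "y \<in> space ?PJ" and neq: "(\<forall>k\<in>J. 0 \<le> y k) \<longrightarrow> (\<Sum>k\<in>J. y k powr p) \<noteq> c"
        define S where "S = (\<Sum>k\<in>J. y k powr p)"
        have S: "(\<Sum>j=1..k. ?X y j powr p) = S"
          using i by (simp add: S_def J_def sum.reindex)
        \<comment> \<open>The constraint splits: the fibre over y is a simplex in the coordinates
          \<open>L\<close> with bound c - S, provided y is nonnegative.\<close>
        have mem: "merge J L (y, z) \<in> lp_simplex p {1..n} c
            \<longleftrightarrow> (\<forall>j\<in>J. 0 \<le> y j) \<and> z \<in> lp_simplex p L (c - S)" if z: "z \<in> space ?PL" for z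
        proof -
          have "(\<Sum>l\<in>{1..n}. merge J L (y, z) l powr p) = S + (\<Sum>l\<in>L. z l powr p)"
          proof -
            have "(\<Sum>l\<in>J. merge J L (y, z) l powr p) = S"
              unfolding S_def by (intro sum.cong) (auto simp: merge_def)
            moreover have "(\<Sum>l\<in>L. merge J L (y, z) l powr p) = (\<Sum>l\<in>L. z l powr p)"
              using JL(1) by (intro sum.cong) (auto simp: merge_def)
            ultimately show ?thesis
              unfolding JL(4)[symmetric] using JL(1-3) by (simp add: sum.union_disjoint)
          qed
          moreover have "(\<forall>l\<in>{1..n}. 0 \<le> merge J L (y, z) l) \<longleftrightarrow> (\<forall>j\<in>J. 0 \<le> y j) \<and> (\<forall>l\<in>L. 0 \<le> z l)"
            unfolding JL(4)[symmetric] using JL(1) by (auto simp: merge_def)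
          moreover have "merge J L (y, z) \<in> {1..n} \<rightarrow>\<^sub>E UNIV"
            unfolding JL(4)[symmetric] by (auto simp: merge_def split: if_splits)
          ultimately show ?thesis
            using z by (auto simp: lp_simplex_def space_PiM)
        qed
        \<comment> \<open>\<open>?X\<close> reads only coordinates in \<open>J\<close>, so the
          indicator of \<open>A\<close> is constant along the fibre.\<close>
        have Xm: "?X (merge J L (y, z)) = ?X y" for z
          by (auto simp: merge_def J_def fun_eq_iff)
        have "(\<integral>\<^sup>+z. indicator (lp_simplex p {1..n} c) (merge J L (y, z))
            * indicator A (?X (merge J L (y, z))) \<partial>?PL)
          = (\<integral>\<^sup>+z. indicator {y. \<forall>j\<in>J. 0 \<le> y j} y * indicator A (?X y)
              * indicator (lp_simplex p L (c - S)) z \<partial>?PL)"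
        proof (rule nn_integral_cong)
          fix z assume "z \<in> space ?PL"
          from mem[OF this] show "indicator (lp_simplex p {1..n} c) (merge J L (y, z))
              * indicator A (?X (merge J L (y, z)))
            = (indicator {y. \<forall>j\<in>J. 0 \<le> y j} y * indicator A (?X y)
              * indicator (lp_simplex p L (c - S)) z :: ennreal)"
            unfolding Xm by (auto simp: indicator_def)
        qed
        also have "\<dots> = indicator {y. \<forall>j\<in>J. 0 \<le> y j} y * indicator A (?X y)
            * emeasure ?PL (lp_simplex p L (c - S))"
          using JL by (subst nn_integral_cmult) auto
        also have "\<dots> = ennreal V * (ennreal (joint_density R p n k (?X y)) * indicator A (?X y))"
        proof (cases "(\<forall>j\<in>J. 0 \<le> y j) \<and> S \<le> c")
          case True
          then have "S < c" using neq by (auto simp: S_def)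
          have "joint_density R p n k (?X y) * V = (Gamma (1 / p) / p) ^ card L * (c - S) powr (card L / p)
              / Gamma (1 + card L / p)"
            using joint_density_eq_ratio[OF R p n kn, of "?X y"] True \<open>S < c\<close> S
            unfolding V_def c_def L by (auto simp: J_def)
          then have "emeasure ?PL (lp_simplex p L (c - S)) = ennreal V * ennreal (joint_density R p n k (?X y))"
            using emeasure_lp_simplex[OF p JL(3), of "c - S"] \<open>S < c\<close> V
            by (simp add: ennreal_mult'[symmetric] mult.commute)
          then show ?thesis using True by (simp add: mult_ac)
        next
          case False
          \<comment> \<open>Both sides vanish: either y has a negative coordinate, or c - S < 0 and
            the fibre is empty.\<close>
          have "joint_density R p n k (?X y) = 0"
            using False S by (auto simp: joint_density_def J_def c_def)
          moreover have "lp_simplex p L (c - S) = {}" if "S > c"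
          proof -
            have "\<not> (\<Sum>l\<in>L. z l powr p) \<le> c - S" for z :: "nat \<Rightarrow> real"
              using that sum_nonneg[of L "\<lambda>l. z l powr p"] by simp
            then show ?thesis by (auto simp: lp_simplex_def)
          qed
          ultimately show ?thesis using False by (auto simp: indicator_def)
        qed
        finally show "(\<integral>\<^sup>+z. indicator (lp_simplex p {1..n} c) (merge J L (y, z))
            * indicator A (?X (merge J L (y, z))) \<partial>?PL)
          = ennreal V * (ennreal (joint_density R p n k (?X y)) * indicator A (?X y))" .
      qed
    qed
    also have "\<dots> = ennreal V * (\<integral>\<^sup>+y. ennreal (joint_density R p n k (?X y)) * indicator A (?X y) \<partial>?PJ)"
      by (rule nn_integral_cmult) measurable
    also have "(\<integral>\<^sup>+y. ennreal (joint_density R p n k (?X y)) * indicator A (?X y) \<partial>?PJ)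
        = (\<integral>\<^sup>+y. ennreal (joint_density R p n k y) * indicator A y \<partial>distr ?PJ ?Q ?X)"
      by (rule nn_integral_distr[OF XJ, symmetric]) measurable
    also have "distr ?PJ ?Q ?X = ?Q"
      unfolding J_def by (rule distr_PiM_lborel_reindex) (use i in auto)
    finally have "emeasure ?P (lp_simplex p {1..n} c \<inter> (?X -` A \<inter> space ?P))
        = ennreal V * (\<integral>\<^sup>+y. ennreal (joint_density R p n k y) * indicator A y \<partial>?Q)" .
    \<comment> \<open>Division by \<open>V\<close>, which is positive and finite.\<close>
    then have "emeasure (uniform_measure ?P (lp_simplex p {1..n} c)) (?X -` A \<inter> space ?P)
        = (\<integral>\<^sup>+y. ennreal (joint_density R p n k y) * indicator A y \<partial>?Q)"
      unfolding emeasure_uniform_measure[OF M pre] volM using V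
      by (simp add: ennreal_mult_divide_eq mult.commute[of "ennreal V"])
    with XU show "emeasure (distr (uniform_measure ?P (lp_simplex p {1..n} c)) ?Q ?X) A
        = emeasure (density ?Q (\<lambda>y. ennreal (joint_density R p n k y))) A"
      using emeasure_density[OF measurable_compose[OF dens measurable_ennreal] A] A
      by (subst emeasure_distr) (simp_all only: space_uniform_measure)
  qed simp
  then show ?thesis
    unfolding distributed_def U lborel_pow_def
    using XU measurable_compose[OF dens measurable_ennreal] by simp
qed

text \<open>The case k = 1 of the joint density, transported from functions on \<open>{1..1}\<close>
  to real numbers by the projection y \<mapsto> y 1.\<close>

lemma distributed_coord:
  fixes R p :: real
  assumes R: "R > 0" and p: "p > 0" and k: "k \<in> {1..n}"
  shows "distributed (uniform_Mplus R p n) lborel (\<lambda>x. x k) (\<lambda>x. ennreal (coord_density R p n x))"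
proof -
  interpret product_sigma_finite "\<lambda>_. lborel :: real measure" ..
  let ?X = "\<lambda>x. \<lambda>j\<in>{1..1::nat}. x k"
  let ?f = "\<lambda>x. ennreal (coord_density R p n x)"
  \<comment> \<open>The index map is constantly \<open>k\<close>, which is injective on a
    singleton.\<close>
  have "distributed (uniform_Mplus R p n) (lborel_pow 1) ?X (\<lambda>y. ennreal (joint_density R p n 1 y))"
    using distributed_joint[OF R p, of 1 "\<lambda>_. k" n] k by auto
  moreover have "joint_density R p n 1 y = coord_density R p n (y 1)" for y
    unfolding coord_density_eq_joint_density[OF R] by (simp add: joint_density_def)
  ultimately have X [measurable]: "?X \<in> uniform_Mplus R p n \<rightarrow>\<^sub>M lborel_pow 1"
    and eq: "distr (uniform_Mplus R p n) (lborel_pow 1) ?X = density (lborel_pow 1) (\<lambda>y. ?f (y 1))"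
    by (simp_all add: distributed_def)
  have f [measurable]: "coord_density R p n \<in> borel_measurable borel"
    unfolding coord_density_def by measurable
  have proj [measurable]: "(\<lambda>y. y 1) \<in> lborel_pow 1 \<rightarrow>\<^sub>M lborel"
    unfolding lborel_pow_def by (rule measurable_component_singleton) simp
  have "(\<lambda>y. y 1) \<circ> ?X \<in> uniform_Mplus R p n \<rightarrow>\<^sub>M lborel"
    by (rule measurable_comp[OF X proj])
  then have meas: "(\<lambda>x. x k) \<in> uniform_Mplus R p n \<rightarrow>\<^sub>M lborel" by (simp add: o_def)
  have "distr (uniform_Mplus R p n) lborel (\<lambda>x. x k)
      = distr (distr (uniform_Mplus R p n) (lborel_pow 1) ?X) lborel (\<lambda>y. y 1)"
    by (subst distr_distr[OF proj X]) (simp add: o_def)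
  also have "\<dots> = density (distr (lborel_pow 1) lborel (\<lambda>y. y 1)) ?f"
    unfolding eq by (subst density_distr[OF _ proj]) auto
  also have "distr (lborel_pow 1) lborel (\<lambda>y. y 1) = lborel"
    using distr_singleton[of "1 :: nat"] by (simp add: lborel_pow_def)
  finally show ?thesis using meas by (simp add: distributed_def)
qed

section \<open>Independence in the limit and assembly of the claims\<close>

lemma indep_vars_limit_law:
  fixes R p :: real
  assumes R: "R > 0" and p: "p > 0" and k: "k \<ge> 1"
  shows "prob_space (limit_law R p k)"
    and "prob_space.indep_vars (limit_law R p k) (\<lambda>_. borel) (\<lambda>j y. y j) {1..k}"
proof -
  have L: "limit_law R p k = (\<Pi>\<^sub>M j\<in>{1..k}. limit_coord_law R p)"
    by (rule limit_law_eq_PiM[OF R p])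
  show P: "prob_space (limit_law R p k)"
    unfolding L by (intro prob_space_PiM prob_space_limit_coord_law R p)
  interpret prob_space "limit_law R p k" by fact
  have "indep_vars (\<lambda>_. limit_coord_law R p) (\<lambda>j y. y j) {1..k}"
    unfolding L by (rule indep_vars_PiM_components) (use k prob_space_limit_coord_law[OF R p] in auto)
  \<comment> \<open>Composing with the identity replaces the target
    \<open>limit_coord_law R p\<close> by \<open>borel\<close>, which has the same measurable
    sets.\<close>
  then show "indep_vars (\<lambda>_. borel) (\<lambda>j y. y j) {1..k}"
    by (rule indep_vars_compose2[where Y = "\<lambda>_ x. x"]) simp
qed

theorem theorem2:
  fixes R p :: real
  assumes "R > 0" and "p \<ge> 1"
  shows
    "(\<forall>n k. 1 \<le> n \<longrightarrow> k \<in> {1..n} \<longrightarrow>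
        distributed (uniform_Mplus R p n) lborel (\<lambda>x. x k)
          (\<lambda>x. ennreal (coord_density R p n x))) \<and>
     (\<forall>x\<ge>0. (\<lambda>n. coord_density R p n x) \<longlonglongrightarrow> coord_density_lim R p x) \<and>
     (\<forall>n k. \<forall>i :: nat \<Rightarrow> nat. 1 \<le> k \<longrightarrow> inj_on i {1..k} \<longrightarrow> i ` {1..k} \<subseteq> {1..n} \<longrightarrow>
        distributed (uniform_Mplus R p n) (lborel_pow k) (\<lambda>x. \<lambda>j\<in>{1..k}. x (i j))
          (\<lambda>y. ennreal (joint_density R p n k y))) \<and>
     (\<forall>k. 1 \<le> k \<longrightarrow>
        (\<forall>y. (\<forall>j\<in>{1..k}. 0 \<le> y j) \<longrightarrow>
          (\<lambda>n. joint_density R p n k y) \<longlonglongrightarrow> joint_density_lim R p k y) \<and>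
        (\<forall>y. joint_density_lim R p k y = (\<Prod>j=1..k. coord_density_lim R p (y j))) \<and>
        prob_space (limit_law R p k) \<and>
        prob_space.indep_vars (limit_law R p k) (\<lambda>_. borel) (\<lambda>j y. y j) {1..k})"
proof -
  have p: "p > 0" using assms by simp
  \<comment> \<open>Convergence of the single-coordinate density is the case k = 1 at a constant
    point.\<close>
  have "(\<lambda>n. coord_density R p n x) \<longlonglongrightarrow> coord_density_lim R p x" if "x \<ge> 0" for x
    unfolding coord_density_eq_joint_density[OF \<open>R > 0\<close>] coord_density_lim_eq_joint_density_lim[OF \<open>R > 0\<close>]
    using that by (intro joint_density_tendsto assms p) auto
  then show ?thesis
    using distributed_coord[OF \<open>R > 0\<close> p] distributed_joint[OF \<open>R > 0\<close> p]
      joint_density_tendsto[OF \<open>R > 0\<close> p] joint_density_lim_eq_prod[OF p, of R]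
      indep_vars_limit_law[OF \<open>R > 0\<close> p]
    by (intro conjI allI impI) auto
qed

end
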